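(* Let $B\in S(n)$ be a symmetric real $n\times n$ matrix. (1) If $B$ is strictly cubically copositive, then $B$ is also strictly copositive. (2) If $n=2$ and $B$ is strictly copositive, then $B$ is also strictly cubically copositive.
   Context: $S(n)$ denotes the space of symmetric $n\times n$ matrices with real coefficients, and $C^n_+=\{c\in\mathbb{R}^n: c_i\ge 0 \text{ for all } i\}$. A matrix $B=(\beta_{ij})_{ij}\in S(n)$ is strictly copositive if $\sum_{i,j=1}^n\beta_{ij}c_ic_j>0$ for all $c\in C^n_+\setminus\{0\}$. It is strictly cubically copositive if there exists $\mu\in C^n_+$ such that $\sum_{i,j=1}^n\beta_{ij}c_j^2c_i\mu_i>0$ for all $c\in C^n_+\setminus\{0\}$. *)

theory Defs
  imports "HOL-Analysis.Analysis"
begin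

definition symmetric_matrices :: "(real^'n^'n) set" where
  "symmetric_matrices = {B. transpose B = B}"

definition nonneg_cone :: "(real^'n) set" where
  "nonneg_cone = {c. \<forall>i. 0 \<le> c $ i}"

definition strictly_copositive :: "real^'n^'n \<Rightarrow> bool" where
  "strictly_copositive B \<longleftrightarrow>
     (\<forall>c \<in> nonneg_cone - {0}. (\<Sum>i\<in>UNIV. \<Sum>j\<in>UNIV. B $ i $ j * c $ i * c $ j) > 0)"

definition strictly_cubically_copositive :: "real^'n^'n \<Rightarrow> bool" where
  "strictly_cubically_copositive B \<longleftrightarrow>
     (\<exists>\<mu> \<in> nonneg_cone. \<forall>c \<in> nonneg_cone - {0}.
        (\<Sum>i\<in>UNIV. \<Sum>j\<in>UNIV. B $ i $ j * (c $ j)\<^sup>2 * c $ i * \<mu> $ i) > 0)"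

end

theory Submission
  imports Defs
begin

text \<open>
  For the first implication, minimise the quadratic form \<open>x \<bullet> (B *v x)\<close> over the unit vectors
  of the nonnegative cone; its minimum has to be shown positive. At a minimiser \<open>c\<close> the first-order conditions say that \<open>B *v c\<close> agrees with \<open>\<lambda> c\<close> on the
  support of \<open>c\<close>, where \<open>\<lambda>\<close> is the minimum (\<open>sphere_minimiser_support_eigenvector\<close>). Now
  test cubic copositivity at the vector \<open>d\<close> with \<open>d\<^sub>j = sqrt c\<^sub>j\<close>: the cubic sum becomes
  \<open>\<Sum>i. d\<^sub>i \<mu>\<^sub>i (B *v c)\<^sub>i\<close>, where only indices in the support contribute, so it equals
  \<open>\<lambda> (\<Sum>i. d\<^sub>i \<mu>\<^sub>i c\<^sub>i)\<close>. The last sum is nonnegative, hence positivity forces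
  \<open>\<lambda> > 0\<close>.

  For the second implication, let \<open>a\<close>, \<open>b\<close>, \<open>d\<close> be the entries of a symmetric
  \<open>2 \<times> 2\<close> matrix. Strict copositivity yields \<open>a = p\<^sup>4\<close> and \<open>d = q\<^sup>4\<close> with
  \<open>p, q > 0\<close>, and \<open>p\<^sup>2 q\<^sup>2 + b > 0\<close>. Rescaling the two variables by \<open>p\<close> and \<open>q\<close>
  normalises the diagonal, so that equal cubic weights work there; in the original variables the
  weights are \<open>q\<close> and \<open>p\<close>. As in the factorisation of a sum of two cubes, the cubic form then has the
  linear factor \<open>p x + q y\<close>, and the bound on \<open>b\<close> makes its cofactor positive on the cone
  away from the origin (\<open>weighted_cubic_pos\<close>).
\<close>

section \<open>Cubic copositivity implies copositivity\<close>

lemma quadratic_sum_eq_inner: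
  fixes B :: "real^'n^'n"
  shows "(\<Sum>i\<in>UNIV. \<Sum>j\<in>UNIV. B $ i $ j * x $ i * x $ j) = x \<bullet> (B *v x)"
  by (simp add: inner_vec_def matrix_vector_mult_def sum_distrib_left mult_ac)

text \<open>
  The derivative at \<open>0\<close> is \<open>k\<close>, and \<open>0\<close> is an interior minimum.
\<close>
lemma linear_coeff_zero_if_local_min:
  fixes k m e :: real
  assumes "e > 0" and nonneg: "\<And>t. \<bar>t\<bar> \<le> e \<Longrightarrow> 0 \<le> k * t + m * t\<^sup>2"
  shows "k = 0"
proof -
  have "((\<lambda>t. k * t + m * t\<^sup>2) has_real_derivative k) (at 0)"
    by (auto intro!: derivative_eq_intros)
  then show ?thesis
    using \<open>e > 0\<close> by (rule DERIV_local_min) (auto intro: nonneg)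
qed

text \<open>
  Moving in a coordinate direction of the support stays in the cone for small steps of either
  sign, so there the first-order condition at a constrained minimum is an equality.
\<close>
lemma sphere_minimiser_support_eigenvector:
  fixes B :: "real^'n^'n"
  assumes sym: "transpose B = B"
  obtains c l where "c \<in> nonneg_cone" "norm c = 1"
    "\<And>x. x \<in> nonneg_cone \<Longrightarrow> l * (x \<bullet> x) \<le> x \<bullet> (B *v x)"
    "\<And>i. c $ i \<noteq> 0 \<Longrightarrow> (B *v c) $ i = l * c $ i"
proof -
  let ?S = "sphere 0 1 \<inter> (nonneg_cone :: (real^'n) set)"
  have "closed (nonneg_cone :: (real^'n) set)"
    unfolding nonneg_cone_def
    by (intro closed_Collect_all closed_Collect_le continuous_intros)
  then have "compact ?S"
    by (simp add: compact_Int_closed)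
  moreover have "axis undefined 1 \<in> ?S"
    using norm_axis_1 by (auto simp: nonneg_cone_def) (simp add: axis_def)
  then have "?S \<noteq> {}" by blast
  moreover have "continuous_on ?S (\<lambda>x. x \<bullet> (B *v x))"
    by (intro continuous_intros)
  ultimately obtain c where c: "c \<in> ?S"
    and min: "\<And>x. x \<in> ?S \<Longrightarrow> c \<bullet> (B *v c) \<le> x \<bullet> (B *v x)"
    using continuous_attains_inf[of ?S "\<lambda>x. x \<bullet> (B *v x)"] by blast
  define l where "l = c \<bullet> (B *v c)"
  have bound: "l * (x \<bullet> x) \<le> x \<bullet> (B *v x)" if x: "x \<in> nonneg_cone" for x
  proof (cases "x = 0")
    case False
    have "l \<le> (x /\<^sub>R norm x) \<bullet> (B *v (x /\<^sub>R norm x))"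
      unfolding l_def using x False by (intro min) (auto simp: nonneg_cone_def)
    then show ?thesis
      using False
      by (simp add: matrix_vector_mult_scaleR dot_square_norm power2_eq_square field_simps)
  qed simp
  have "(B *v c) $ i = l * c $ i" if "c $ i \<noteq> 0" for i
  proof -
    let ?e = "axis i (1::real)"
    have pos: "c $ i > 0"
      using c that by (auto simp: nonneg_cone_def less_le)
    have cc: "c \<bullet> c = 1"
      using c by (simp add: dot_square_norm)
    have adj: "c \<bullet> (B *v ?e) = ?e \<bullet> (B *v c)"
      by (metis sym dot_lmul_matrix inner_commute transpose_matrix_vector)
    have "0 \<le> (2 * ((B *v c) $ i - l * c $ i)) * t + (?e \<bullet> (B *v ?e) - l) * t\<^sup>2"
      if t: "\<bar>t\<bar> \<le> c $ i" for t
    proof -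
      have "c + t *\<^sub>R ?e \<in> nonneg_cone"
        using c t by (auto simp: nonneg_cone_def axis_def)
      from bound[OF this] show ?thesis
        using cc adj
        by (simp add: matrix_vector_right_distrib matrix_vector_mult_scaleR inner_add_left
            inner_add_right inner_axis inner_axis' l_def[symmetric] power2_eq_square algebra_simps)
    qed
    from linear_coeff_zero_if_local_min[OF pos this] show ?thesis by simp
  qed
  with c bound show ?thesis
    by (intro that[of c l]) auto
qed

lemma strictly_cubically_copositive_imp_strictly_copositive:
  fixes B :: "real^'n^'n"
  assumes sym: "transpose B = B" and cubic: "strictly_cubically_copositive B"
  shows "strictly_copositive B"
proof -
  obtain \<mu> where \<mu>: "\<mu> \<in> nonneg_cone"
    and pos: "\<And>c. c \<in> nonneg_cone - {0} \<Longrightarrow>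
      (\<Sum>i\<in>UNIV. \<Sum>j\<in>UNIV. B $ i $ j * (c $ j)\<^sup>2 * c $ i * \<mu> $ i) > 0"
    using cubic unfolding strictly_cubically_copositive_def by blast
  obtain c l where c: "c \<in> nonneg_cone" "norm c = 1"
    and bound: "\<And>x. x \<in> nonneg_cone \<Longrightarrow> l * (x \<bullet> x) \<le> x \<bullet> (B *v x)"
    and eig: "\<And>i. c $ i \<noteq> 0 \<Longrightarrow> (B *v c) $ i = l * c $ i"
    using sphere_minimiser_support_eigenvector[OF sym] by blast
  define d :: "real^'n" where "d = (\<chi> j. sqrt (c $ j))"
  have c_nonneg: "0 \<le> c $ j" and \<mu>_nonneg: "0 \<le> \<mu> $ j" for j
    using c \<mu> by (auto simp: nonneg_cone_def)
  have "c \<noteq> 0" using c by auto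
  then have d: "d \<in> nonneg_cone - {0}"
    using c_nonneg by (auto simp: d_def nonneg_cone_def vec_eq_iff)
  have "(\<Sum>i\<in>UNIV. \<Sum>j\<in>UNIV. B $ i $ j * (d $ j)\<^sup>2 * d $ i * \<mu> $ i)
      = (\<Sum>i\<in>UNIV. d $ i * \<mu> $ i * (B *v c) $ i)"
    using c_nonneg
    by (simp add: d_def matrix_vector_mult_def sum_distrib_left mult_ac)
  also have "\<dots> = (\<Sum>i\<in>UNIV. l * (d $ i * \<mu> $ i * c $ i))"
  proof (rule sum.cong[OF refl])
    fix i
    show "d $ i * \<mu> $ i * (B *v c) $ i = l * (d $ i * \<mu> $ i * c $ i)"
      using eig[of i] by (cases "c $ i = 0") (auto simp: d_def)
  qed
  also have "\<dots> = l * (\<Sum>i\<in>UNIV. d $ i * \<mu> $ i * c $ i)"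
    by (simp add: sum_distrib_left)
  finally have "0 < l * (\<Sum>i\<in>UNIV. d $ i * \<mu> $ i * c $ i)"
    using pos[OF d] by simp
  moreover have "0 \<le> (\<Sum>i\<in>UNIV. d $ i * \<mu> $ i * c $ i)"
    using c_nonneg \<mu>_nonneg by (intro sum_nonneg) (auto simp: d_def)
  ultimately have "l > 0"
    by (simp add: zero_less_mult_iff)
  show ?thesis
    unfolding strictly_copositive_def quadratic_sum_eq_inner
  proof
    fix x :: "real^'n"
    assume x: "x \<in> nonneg_cone - {0}"
    then have "0 < l * (x \<bullet> x)"
      using \<open>l > 0\<close> by simp
    also have "\<dots> \<le> x \<bullet> (B *v x)"
      using x by (intro bound) auto
    finally show "0 < x \<bullet> (B *v x)" .
  qed
qed

section \<open>The converse in dimension two\<close>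

text \<open>
  With \<open>X = p x\<close> and \<open>Y = q y\<close> the left-hand side is
  \<open>p q (X\<^sup>3 + Y\<^sup>3) + (b / (p q)) X Y (X + Y)\<close>, from which \<open>X + Y\<close> splits off.
\<close>
lemma weighted_cubic_pos:
  fixes p q b x y :: real
  assumes "p > 0" "q > 0" "p\<^sup>2 * q\<^sup>2 + b > 0" "x \<ge> 0" "y \<ge> 0" "x \<noteq> 0 \<or> y \<noteq> 0"
  shows "p ^ 4 * x\<^sup>2 * x * q + b * y\<^sup>2 * x * q + b * x\<^sup>2 * y * p + q ^ 4 * y\<^sup>2 * y * p > 0"
proof -
  have "p * x + q * y > 0"
    using assms by (metis add_nonneg_pos add_pos_nonneg less_le mult_nonneg_nonneg mult_pos_pos)
  moreover have "p * q * (p * x - q * y)\<^sup>2 + (p\<^sup>2 * q\<^sup>2 + b) * (x * y) > 0"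
  proof (cases "x = 0 \<or> y = 0")
    case True
    then show ?thesis using assms by auto
  next
    case False
    then have "(p\<^sup>2 * q\<^sup>2 + b) * (x * y) > 0"
      using assms by (intro mult_pos_pos) auto
    then show ?thesis
      using assms by (intro add_nonneg_pos) auto
  qed
  ultimately have
    "(p * x + q * y) * (p * q * (p * x - q * y)\<^sup>2 + (p\<^sup>2 * q\<^sup>2 + b) * (x * y)) > 0"
    by (rule mult_pos_pos)
  then show ?thesis
    by (simp add: power2_eq_square power4_eq_xxxx algebra_simps)
qed

lemma strictly_copositive_imp_strictly_cubically_copositive_2:
  fixes B :: "real^'n^'n"
  assumes sym: "transpose B = B" and dim: "CARD('n) = 2" and copos: "strictly_copositive B"
  shows "strictly_cubically_copositive B"
proof -
  obtain u v :: 'n where UNIV_eq: "UNIV = {u, v}" and "u \<noteq> v"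
    using dim by (auto simp: card_2_iff)
  define a b d where "a = B $ u $ u" and "b = B $ u $ v" and "d = B $ v $ v"
  have b': "B $ v $ u = b"
    using sym by (metis b_def transpose_def vec_lambda_beta)
  have all_iff: "(\<forall>i. P i) \<longleftrightarrow> P u \<and> P v" for P
    using UNIV_eq by (metis UNIV_I insertE singletonD)
  have form_pos: "0 < a * x * x + b * x * y + (b * y * x + d * y * y)"
    if "x \<ge> 0" "y \<ge> 0" "x \<noteq> 0 \<or> y \<noteq> 0" for x y
  proof -
    let ?c = "(\<chi> i. if i = u then x else y) :: real^'n"
    have "?c \<in> nonneg_cone - {0}"
      using that \<open>u \<noteq> v\<close> by (auto simp: nonneg_cone_def vec_eq_iff all_iff)
    then have "0 < (\<Sum>i\<in>UNIV. \<Sum>j\<in>UNIV. B $ i $ j * ?c $ i * ?c $ j)"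
      using copos unfolding strictly_copositive_def by blast
    then show ?thesis
      using \<open>u \<noteq> v\<close> b' by (simp add: UNIV_eq a_def b_def d_def add_ac)
  qed
  have "a > 0" "d > 0"
    using form_pos[of 1 0] form_pos[of 0 1] by simp_all
  define p q where "p = sqrt (sqrt a)" and "q = sqrt (sqrt d)"
  have pq: "p > 0" "q > 0"
    using \<open>a > 0\<close> \<open>d > 0\<close> by (simp_all add: p_def q_def)
  have a: "a = p ^ 4" and d: "d = q ^ 4"
    using \<open>a > 0\<close> \<open>d > 0\<close> by (simp_all add: p_def q_def power4_eq_xxxx mult.assoc)
  \<comment> \<open>At \<open>(q\<^sup>2, p\<^sup>2)\<close> the two diagonal terms of the quadratic form are equal, which makes the
    resulting bound on \<open>b\<close> sharp.\<close>
  have "0 < (2 * p\<^sup>2 * q\<^sup>2) * (p\<^sup>2 * q\<^sup>2 + b)"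
    using form_pos[of "q\<^sup>2" "p\<^sup>2"] pq
    by (simp add: a d power2_eq_square power4_eq_xxxx algebra_simps)
  then have b: "p\<^sup>2 * q\<^sup>2 + b > 0"
    by (rule zero_less_mult_pos) (use pq in simp)
  define \<mu> :: "real^'n" where "\<mu> = (\<chi> i. if i = u then q else p)"
  have "\<mu> \<in> nonneg_cone"
    using pq by (auto simp: \<mu>_def nonneg_cone_def)
  moreover have "0 < (\<Sum>i\<in>UNIV. \<Sum>j\<in>UNIV. B $ i $ j * (c $ j)\<^sup>2 * c $ i * \<mu> $ i)"
    if "c \<in> nonneg_cone - {0}" for c
  proof -
    have "c $ u \<ge> 0" "c $ v \<ge> 0" "c $ u \<noteq> 0 \<or> c $ v \<noteq> 0"
      using that by (auto simp: nonneg_cone_def vec_eq_iff all_iff)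
    from weighted_cubic_pos[OF pq b this] show ?thesis
      using \<open>u \<noteq> v\<close> b' a d by (simp add: UNIV_eq \<mu>_def a_def b_def d_def add_ac)
  qed
  ultimately show ?thesis
    unfolding strictly_cubically_copositive_def by blast
qed

theorem proposition1p2:
  fixes B :: "real^'n^'n"
  assumes "B \<in> symmetric_matrices"
  shows "(strictly_cubically_copositive B \<longrightarrow> strictly_copositive B) \<and>
         (CARD('n) = 2 \<and> strictly_copositive B \<longrightarrow> strictly_cubically_copositive B)"
  using assms strictly_cubically_copositive_imp_strictly_copositive
    strictly_copositive_imp_strictly_cubically_copositive_2
  by (auto simp: symmetric_matrices_def)

end
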